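(* Let $\varrho\in[0,1)$ and consider an instance of SEBP whose processing times $P_1,\dots,P_n$ each have Pietra index at most $\varrho$. Then $$\frac{\mathrm{LEPT}_{\mathcal F}}{OPT_{\mathcal P}}\le2\big(2-\sqrt2+\varrho(\sqrt2-1)\big).$$
   Context: The Pietra index of a nonnegative random variable $Y$ with finite positive mean $\mu$ is $P_Y=\frac{1}{2\mu}\mathbb E[|Y-\mu|]$; equivalently $P_Y=\max_{p\in[0,1]}(p-L_Y(p))$ where $L_Y(p)=\frac1\mu\int_0^pF_Y^{-1}(z)\,dz$ is the Lorenz curve and $F_Y^{-1}(z)=\inf\{y:F_Y(y)\ge z\}$. SEBP: an instance consists of $m$ identical machines with unit regular capacity and $n>m$ jobs with mutually independent nonnegative processing times $P_1,\dots,P_n$ of finite expectation. A scheduling policy maps realizations to feasible schedules (start times and machine assignments, no machine running two jobs at once) non-anticipatively; its cost is $\Phi(\Pi)=\mathbb E[\sum_i\max(X_i^\Pi,1)]$ where $X_i^\Pi$ is the latest completion time on machine $i$; $OPT_{\mathcal P}$ is the infimum of $\Phi$ over all scheduling policies. $\mathrm{LEPT}_{\mathcal F}$ considers jobs in nonincreasing order of $\mathbb E[P_j]$ and assigns each to a machine with currently smallest total expected load; the assignment is fixed in advance, machines process their jobs without idle time, and $\mathrm{LEPT}_{\mathcal F}$ also denotes its cost. *)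

theory Defs
  imports "HOL-Probability.Probability"
begin

definition pietra_index :: "'a measure \<Rightarrow> ('a \<Rightarrow> real) \<Rightarrow> real" where
  "pietra_index M Y =
     (\<integral>\<omega>. \<bar>Y \<omega> - (\<integral>\<omega>'. Y \<omega>' \<partial>M)\<bar> \<partial>M) / (2 * (\<integral>\<omega>. Y \<omega> \<partial>M))"

text \<open>
  Jobs are the numbers below \<open>n\<close>, machines the numbers below \<open>m\<close>.
\<close>

record schedule =
  start :: "nat \<Rightarrow> real"
  machine :: "nat \<Rightarrow> nat"

definition feasible :: "nat \<Rightarrow> nat \<Rightarrow> (nat \<Rightarrow> real) \<Rightarrow> schedule \<Rightarrow> bool" where
  "feasible m n p S \<longleftrightarrow>
     (\<forall>j<n. 0 \<le> start S j \<and> machine S j < m) \<and>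
     (\<forall>j<n. \<forall>k<n. j \<noteq> k \<and> machine S j = machine S k \<longrightarrow>
        start S j + p j \<le> start S k \<or> start S k + p k \<le> start S j)"

definition realizations :: "nat \<Rightarrow> (nat \<Rightarrow> real) set" where
  "realizations n = (\<Pi>\<^sub>E j\<in>{..<n}. {0..})"

definition same_decision :: "schedule \<Rightarrow> schedule \<Rightarrow> nat \<Rightarrow> bool" where
  "same_decision S S' j \<longleftrightarrow> start S j = start S' j \<and> machine S j = machine S' j"

text \<open>
  The processing time of a job is observed no earlier than its completion. So two
  realizations \<open>p\<close> and \<open>q\<close> can be told apart at time \<open>t\<close> only through a job \<open>k\<close> that is started
  in the same way under both and for which \<open>p k \<noteq> q k\<close>, once the shorter of the two
  executions is over. As long as there is no such job, the decisions taken up to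
  time \<open>t\<close> (inclusive) have to coincide. Restricting to jobs \<open>k\<close> started in the same way matters
  only for jobs of length zero: such a job is observed at the very time it is started,
  and it may influence other decisions at that time, but not the decision to start it.
\<close>

definition nonanticipative :: "nat \<Rightarrow> ((nat \<Rightarrow> real) \<Rightarrow> schedule) \<Rightarrow> bool" where
  "nonanticipative n pol \<longleftrightarrow>
     (\<forall>p\<in>realizations n. \<forall>q\<in>realizations n. \<forall>t.
        (\<forall>k<n. same_decision (pol p) (pol q) k \<and> p k \<noteq> q k \<longrightarrow>
                 t < start (pol p) k + min (p k) (q k)) \<longrightarrow>
        (\<forall>j<n. start (pol p) j \<le> t \<or> start (pol q) j \<le> t \<longrightarrow>
                 same_decision (pol p) (pol q) j))"

text \<open>
  Measurability is what makes the expected cost of a policy well defined.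
\<close>

definition scheduling_policies :: "nat \<Rightarrow> nat \<Rightarrow> ((nat \<Rightarrow> real) \<Rightarrow> schedule) set" where
  "scheduling_policies m n =
     {pol. (\<forall>p\<in>realizations n. feasible m n p (pol p)) \<and>
          nonanticipative n pol \<and>
          (\<forall>j<n. (\<lambda>p. start (pol p) j)
             \<in> restrict_space (\<Pi>\<^sub>M j\<in>{..<n}. borel) (realizations n) \<rightarrow>\<^sub>M borel) \<and>
          (\<forall>j<n. (\<lambda>p. machine (pol p) j)
             \<in> restrict_space (\<Pi>\<^sub>M j\<in>{..<n}. borel) (realizations n) \<rightarrow>\<^sub>M count_space UNIV)}"

text \<open>
  A machine without jobs has latest completion time \<open>0\<close>.
\<close>

definition latest_completion :: "nat \<Rightarrow> (nat \<Rightarrow> real) \<Rightarrow> schedule \<Rightarrow> nat \<Rightarrow> real" where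
  "latest_completion n p S i =
     Max (insert 0 {start S j + p j |j. j < n \<and> machine S j = i})"

definition expected_cost ::
  "'a measure \<Rightarrow> (nat \<Rightarrow> 'a \<Rightarrow> real) \<Rightarrow> nat \<Rightarrow> nat \<Rightarrow> ((nat \<Rightarrow> real) \<Rightarrow> schedule) \<Rightarrow> ennreal" where
  "expected_cost M P m n pol =
     (\<integral>\<^sup>+ \<omega>. (let p = (\<lambda>j\<in>{..<n}. P j \<omega>)
             in ennreal (\<Sum>i<m. max (latest_completion n p (pol p) i) 1)) \<partial>M)"

definition opt_policy_cost :: "'a measure \<Rightarrow> (nat \<Rightarrow> 'a \<Rightarrow> real) \<Rightarrow> nat \<Rightarrow> nat \<Rightarrow> ennreal" where
  "opt_policy_cost M P m n = (INF pol\<in>scheduling_policies m n. expected_cost M P m n pol)"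

text \<open>
  \<open>pos\<close> gives the order in which jobs are considered, \<open>A\<close> is the resulting assignment, and
  \<open>\<mu>\<close> are the expected processing times. Ties, both between jobs and between machines,
  may be broken in any way.
\<close>

definition lept_assignment ::
  "nat \<Rightarrow> nat \<Rightarrow> (nat \<Rightarrow> real) \<Rightarrow> (nat \<Rightarrow> nat) \<Rightarrow> (nat \<Rightarrow> nat) \<Rightarrow> bool" where
  "lept_assignment m n \<mu> pos A \<longleftrightarrow>
     inj_on pos {..<n} \<and>
     (\<forall>j<n. \<forall>k<n. pos j < pos k \<longrightarrow> \<mu> k \<le> \<mu> j) \<and>
     (\<forall>j<n. A j < m \<and>
        (\<forall>i<m. (\<Sum>k | k < n \<and> pos k < pos j \<and> A k = A j. \<mu> k)
              \<le> (\<Sum>k | k < n \<and> pos k < pos j \<and> A k = i. \<mu> k)))"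

definition fixed_assignment_policy ::
  "nat \<Rightarrow> (nat \<Rightarrow> nat) \<Rightarrow> (nat \<Rightarrow> nat) \<Rightarrow> (nat \<Rightarrow> real) \<Rightarrow> schedule" where
  "fixed_assignment_policy n pos A p =
     \<lparr>start = (\<lambda>j. \<Sum>k | k < n \<and> pos k < pos j \<and> A k = A j. p k), machine = A\<rparr>"

end

theory Submission
  imports Defs
begin

text \<open>
  Write \<open>x\<^sub>i\<close> for the expected load of machine \<open>i\<close> under LEPT. The Pietra bound carries over from
  the jobs to the load of a machine, and convexity of \<open>c \<mapsto> E (S - c)\<^sup>+\<close> then gives
  \<open>E max(S\<^sub>i, 1) \<le> max(x\<^sub>i, 1) + \<rho> min(x\<^sub>i, 1) = (1 - \<rho>) max(x\<^sub>i, 1) + \<rho> (1 + x\<^sub>i)\<close>.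

  Realization by realization, a schedule costs at least the total processing time, and at least
  the processing time of any set \<open>K\<close> of jobs plus \<open>m - |K|\<close>, because at least \<open>m - |K|\<close> machines
  receive no job of \<open>K\<close>. So only \<open>\<Sum>\<^sub>i max(x\<^sub>i, 1)\<close> has to be compared with these bounds. Take for
  \<open>K\<close> the jobs that are alone on a machine with \<open>x\<^sub>i > 1\<close>. A machine with at least two jobs has
  \<open>x\<^sub>i \<le> 2l\<close>, where \<open>l\<close> is the smallest load. On \<open>[l, 2l]\<close> with \<open>1/2 \<le> l \<le> 1\<close> the function
  \<open>max(x, 1)\<close> lies below the chord \<open>(2 - 1/l) x + (2 - 2l)\<close>, whose two coefficients add up to
  \<open>4 - 2l - 1/l \<le> 4 - 2 sqrt 2\<close>.
\<close>

lemma feasible_load_le_latest_completion: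
  assumes feas: "feasible m n p S" and nonneg: "\<And>j. j < n \<Longrightarrow> 0 \<le> p j"
  shows "(\<Sum>j | j < n \<and> machine S j = i. p j) \<le> latest_completion n p S i"
proof -
  let ?C = "latest_completion n p S i"
  define J where "J = {j. j < n \<and> machine S j = i}"
  define I where "I j = {start S j ..< start S j + p j}" for j
  have fin: "finite J" by (simp add: J_def)
  have C: "start S j + p j \<le> ?C" if "j \<in> J" for j
    unfolding latest_completion_def using that by (intro Max_ge) (auto simp: J_def)
  have C0: "0 \<le> ?C"
    unfolding latest_completion_def by (intro Max_ge) auto
  have disj: "disjoint_family_on I J"
    unfolding disjoint_family_on_def
  proof (intro ballI impI)
    fix j k assume "j \<in> J" "k \<in> J" "j \<noteq> k"
    then have "start S j + p j \<le> start S k \<or> start S k + p k \<le> start S j"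
      using feas by (auto simp: feasible_def J_def)
    then show "I j \<inter> I k = {}" by (auto simp: I_def)
  qed
  have "(\<Sum>j\<in>J. p j) = (\<Sum>j\<in>J. measure lborel (I j))"
    using nonneg by (intro sum.cong) (auto simp: I_def J_def)
  also have "\<dots> = measure lborel (\<Union>j\<in>J. I j)"
    using nonneg by (intro measure_finite_Union[OF fin _ disj, symmetric]) (auto simp: I_def J_def)
  also have "\<dots> \<le> measure lborel {0..<?C}"
  proof (rule measure_mono_fmeasurable)
    show "(\<Union>j\<in>J. I j) \<subseteq> {0..<?C}"
      using feas C by (force simp: I_def J_def feasible_def)
    show "(\<Union>j\<in>J. I j) \<in> sets lborel"
      using fin by (auto simp: I_def)
    show "{0..<?C} \<in> fmeasurable lborel"
      using C0 by (intro fmeasurableI) auto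
  qed
  also have "\<dots> = ?C" using C0 by simp
  finally show ?thesis by (simp add: J_def)
qed

lemma sum_by_machine:
  fixes f :: "'j \<Rightarrow> 'b::comm_monoid_add" and a :: "'j \<Rightarrow> nat"
  assumes "finite K" "\<And>j. j \<in> K \<Longrightarrow> a j < m"
  shows "(\<Sum>i<m. \<Sum>j | j \<in> K \<and> a j = i. f j) = (\<Sum>j\<in>K. f j)"
  using assms by (intro sum.group) auto

lemma feasible_cost_ge_total:
  assumes feas: "feasible m n p S" and nonneg: "\<And>j. j < n \<Longrightarrow> 0 \<le> p j"
  shows "(\<Sum>j<n. p j) \<le> (\<Sum>i<m. max (latest_completion n p S i) 1)"
proof -
  have "(\<Sum>j<n. p j) = (\<Sum>i<m. \<Sum>j | j \<in> {..<n} \<and> machine S j = i. p j)"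
    using feas by (intro sum_by_machine[symmetric]) (auto simp: feasible_def)
  also have "\<dots> \<le> (\<Sum>i<m. max (latest_completion n p S i) 1)"
    using feasible_load_le_latest_completion[OF feas nonneg]
    by (intro sum_mono) (auto simp: le_max_iff_disj)
  finally show ?thesis .
qed

lemma feasible_cost_ge_subset:
  assumes feas: "feasible m n p S" and nonneg: "\<And>j. j < n \<Longrightarrow> 0 \<le> p j"
    and K: "K \<subseteq> {..<n}"
  shows "(\<Sum>j\<in>K. p j) + (real m - real (card K))
           \<le> (\<Sum>i<m. max (latest_completion n p S i) 1)"
proof -
  let ?K = "\<lambda>i. {j. j \<in> K \<and> machine S j = i}"
  have fin: "finite K" using K finite_subset by blast
  have mach: "machine S j < m" if "j \<in> K" for j
    using that K feas by (auto simp: feasible_def)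
  have "real (card K) = (\<Sum>i<m. real (card (?K i)))"
    using sum_by_machine[of K "machine S" m "\<lambda>_. 1::real"] fin mach by simp
  then have "(\<Sum>j\<in>K. p j) + (real m - real (card K))
      = (\<Sum>i<m. (\<Sum>j\<in>?K i. p j) + (1 - real (card (?K i))))"
    using sum_by_machine[of K "machine S" m p] fin mach
    by (simp add: sum.distrib sum_subtractf)
  also have "\<dots> \<le> (\<Sum>i<m. max (latest_completion n p S i) 1)"
  proof (rule sum_mono)
    fix i
    have "(\<Sum>j\<in>?K i. p j) \<le> (\<Sum>j | j < n \<and> machine S j = i. p j)"
      using K nonneg by (intro sum_mono2) auto
    then have le: "(\<Sum>j\<in>?K i. p j) \<le> latest_completion n p S i"
      using feasible_load_le_latest_completion[OF feas nonneg, of i] by simp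
    show "(\<Sum>j\<in>?K i. p j) + (1 - real (card (?K i))) \<le> max (latest_completion n p S i) 1"
    proof (cases "?K i = {}")
      case True
      show ?thesis unfolding True by simp
    next
      case False
      have "finite (?K i)" using fin by simp
      then have "card (?K i) \<noteq> 0" using False by (simp only: card_0_eq not_False_eq_True)
      then have "1 - real (card (?K i)) \<le> 0" by simp
      then show ?thesis using le by (smt (verit))
    qed
  qed
  finally show ?thesis .
qed

lemma opt_policy_cost_ge:
  assumes "\<And>p S. p \<in> realizations n \<Longrightarrow> feasible m n p S \<Longrightarrow>
             f p \<le> (\<Sum>i<m. max (latest_completion n p S i) 1)"
    and nonneg: "\<And>j \<omega>. j < n \<Longrightarrow> \<omega> \<in> space M \<Longrightarrow> 0 \<le> P j \<omega>"
    and int: "integrable M (\<lambda>\<omega>. f (\<lambda>j\<in>{..<n}. P j \<omega>))"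
  shows "ennreal (\<integral>\<omega>. f (\<lambda>j\<in>{..<n}. P j \<omega>) \<partial>M) \<le> opt_policy_cost M P m n"
  unfolding opt_policy_cost_def
proof (rule INF_greatest)
  fix pol assume pol: "pol \<in> scheduling_policies m n"
  have "(\<integral>\<omega>. f (\<lambda>j\<in>{..<n}. P j \<omega>) \<partial>M) \<le> (\<integral>\<omega>. max 0 (f (\<lambda>j\<in>{..<n}. P j \<omega>)) \<partial>M)"
    using int by (intro integral_mono) auto
  then have "ennreal (\<integral>\<omega>. f (\<lambda>j\<in>{..<n}. P j \<omega>) \<partial>M)
      \<le> ennreal (\<integral>\<omega>. max 0 (f (\<lambda>j\<in>{..<n}. P j \<omega>)) \<partial>M)"
    by (rule ennreal_leI)
  also have "\<dots> = (\<integral>\<^sup>+\<omega>. ennreal (max 0 (f (\<lambda>j\<in>{..<n}. P j \<omega>))) \<partial>M)"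
    using int by (intro nn_integral_eq_integral[symmetric]) auto
  also have "\<dots> = (\<integral>\<^sup>+\<omega>. ennreal (f (\<lambda>j\<in>{..<n}. P j \<omega>)) \<partial>M)"
    by (simp add: ennreal_max_0)
  also have "\<dots> \<le> expected_cost M P m n pol"
    unfolding expected_cost_def Let_def
  proof (rule nn_integral_mono, rule ennreal_leI)
    fix \<omega> assume "\<omega> \<in> space M"
    then have "(\<lambda>j\<in>{..<n}. P j \<omega>) \<in> realizations n"
      using nonneg by (auto simp: realizations_def)
    then show "f (\<lambda>j\<in>{..<n}. P j \<omega>) \<le>
      (\<Sum>i<m. max (latest_completion n (\<lambda>j\<in>{..<n}. P j \<omega>) (pol (\<lambda>j\<in>{..<n}. P j \<omega>)) i) 1)"
      using assms(1) pol by (auto simp: scheduling_policies_def)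
  qed
  finally show "ennreal (\<integral>\<omega>. f (\<lambda>j\<in>{..<n}. P j \<omega>) \<partial>M) \<le> expected_cost M P m n pol" .
qed

lemma latest_completion_fixed_assignment_le:
  assumes nonneg: "\<And>j. j < n \<Longrightarrow> 0 \<le> p j"
  shows "latest_completion n p (fixed_assignment_policy n pos A p) i
           \<le> (\<Sum>j | j < n \<and> A j = i. p j)"
  unfolding latest_completion_def
proof (rule Max.boundedI)
  fix c assume "c \<in> insert 0 {start (fixed_assignment_policy n pos A p) j + p j |j.
      j < n \<and> machine (fixed_assignment_policy n pos A p) j = i}"
  then consider "c = 0" | j where "j < n" "A j = i"
      "c = (\<Sum>k | k < n \<and> pos k < pos j \<and> A k = i. p k) + p j"
    by (auto simp: fixed_assignment_policy_def)
  then show "c \<le> (\<Sum>j | j < n \<and> A j = i. p j)"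
  proof cases
    case 1
    then show ?thesis using nonneg by (auto intro: sum_nonneg)
  next
    case (2 j)
    then have "c = (\<Sum>k\<in>insert j {k. k < n \<and> pos k < pos j \<and> A k = i}. p k)"
      by simp
    also have "\<dots> \<le> (\<Sum>j | j < n \<and> A j = i. p j)"
      using 2 nonneg by (intro sum_mono2) auto
    finally show ?thesis .
  qed
qed auto

lemma (in prob_space) expectation_max_1_le:
  fixes S :: "'a \<Rightarrow> real"
  assumes int: "integrable M S" and nonneg: "\<And>\<omega>. \<omega> \<in> space M \<Longrightarrow> 0 \<le> S \<omega>"
    and x: "x = expectation S" and dev: "expectation (\<lambda>\<omega>. \<bar>S \<omega> - x\<bar>) \<le> 2 * \<rho> * x"
  shows "expectation (\<lambda>\<omega>. max (S \<omega>) 1) \<le> max x 1 + \<rho> * min x 1"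
proof -
  define D where "D = (\<lambda>\<omega>. (\<bar>S \<omega> - x\<bar> + (S \<omega> - x)) / 2)"
  have D_int: "integrable M D" unfolding D_def using int by auto
  have "expectation D = (expectation (\<lambda>\<omega>. \<bar>S \<omega> - x\<bar>) + (expectation S - x)) / 2"
    unfolding D_def using int by (simp add: prob_space)
  then have ED: "expectation D \<le> \<rho> * x" using dev x by simp
  have D: "D \<omega> = max (S \<omega> - x) 0" for \<omega> unfolding D_def by (auto simp: max_def)
  have max_int: "integrable M (\<lambda>\<omega>. max (S \<omega>) 1)" using int by auto
  show ?thesis
  proof (cases "x \<le> 1")
    case True
    have "expectation (\<lambda>\<omega>. max (S \<omega>) 1) \<le> expectation (\<lambda>\<omega>. 1 + D \<omega>)"
    proof (rule integral_mono)
      show "max (S \<omega>) 1 \<le> 1 + D \<omega>" for \<omega> using True by (auto simp: D)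
    qed (use max_int D_int in auto)
    also have "\<dots> = 1 + expectation D" using D_int by (simp add: prob_space)
    finally show ?thesis using ED True by simp
  next
    case False
    have *: "max (S \<omega>) 1 \<le> 1 + (1 - 1/x) * S \<omega> + (1/x) * D \<omega>" if "\<omega> \<in> space M" for \<omega>
    proof -
      have "0 \<le> S \<omega> * (x - 1)" using nonneg[OF that] False by simp
      then show ?thesis using False
        by (cases "S \<omega> \<le> x"; cases "S \<omega> \<le> 1") (auto simp: D max_def field_simps)
    qed
    have "expectation (\<lambda>\<omega>. max (S \<omega>) 1) \<le> expectation (\<lambda>\<omega>. 1 + (1 - 1/x) * S \<omega> + (1/x) * D \<omega>)"
      using max_int D_int int * by (intro integral_mono) auto
    also have "\<dots> = 1 + (1 - 1/x) * x + (1/x) * expectation D"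
      using D_int int by (simp add: prob_space x)
    also have "\<dots> \<le> 1 + (1 - 1/x) * x + (1/x) * (\<rho> * x)"
      using ED False by (intro add_left_mono mult_left_mono) auto
    also have "\<dots> = x + \<rho>" using False by (simp add: field_simps)
    finally show ?thesis using False by simp
  qed
qed

lemma (in prob_space) fixed_assignment_cost_le:
  assumes nonneg: "\<And>j \<omega>. j < n \<Longrightarrow> \<omega> \<in> space M \<Longrightarrow> 0 \<le> P j \<omega>"
    and int: "\<And>j. j < n \<Longrightarrow> integrable M (P j)"
    and pos: "\<And>j. j < n \<Longrightarrow> 0 < expectation (P j)"
    and pietra: "\<And>j. j < n \<Longrightarrow> pietra_index M (P j) \<le> \<rho>"
    and x: "\<And>i. x i = (\<Sum>j | j < n \<and> A j = i. expectation (P j))"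
  shows "expected_cost M P m n (fixed_assignment_policy n pos A)
           \<le> ennreal (\<Sum>i<m. max (x i) 1 + \<rho> * min (x i) 1)"
proof -
  define S where "S = (\<lambda>i \<omega>. \<Sum>j | j < n \<and> A j = i. P j \<omega>)"
  have S_int: "integrable M (S i)" for i unfolding S_def using int by auto
  have S_nonneg: "0 \<le> S i \<omega>" if "\<omega> \<in> space M" for i \<omega>
    unfolding S_def using nonneg that by (intro sum_nonneg) auto
  have ES: "x i = expectation (S i)" for i
    unfolding S_def x using int by (subst Bochner_Integration.integral_sum) auto
  have dev: "expectation (\<lambda>\<omega>. \<bar>S i \<omega> - x i\<bar>) \<le> 2 * \<rho> * x i" for i
  proof -
    have "expectation (\<lambda>\<omega>. \<bar>S i \<omega> - x i\<bar>)
        \<le> expectation (\<lambda>\<omega>. \<Sum>j | j < n \<and> A j = i. \<bar>P j \<omega> - expectation (P j)\<bar>)"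
    proof (rule integral_mono)
      show "\<bar>S i \<omega> - x i\<bar> \<le> (\<Sum>j | j < n \<and> A j = i. \<bar>P j \<omega> - expectation (P j)\<bar>)" for \<omega>
        unfolding S_def x sum_subtractf[symmetric] by (rule sum_abs)
    qed (use S_int int in auto)
    also have "\<dots> = (\<Sum>j | j < n \<and> A j = i. expectation (\<lambda>\<omega>. \<bar>P j \<omega> - expectation (P j)\<bar>))"
      using int by (intro Bochner_Integration.integral_sum) auto
    also have "\<dots> \<le> (\<Sum>j | j < n \<and> A j = i. 2 * \<rho> * expectation (P j))"
      using pietra pos
      by (intro sum_mono) (auto simp: pietra_index_def divide_le_eq mult_ac)
    also have "\<dots> = 2 * \<rho> * x i" by (simp add: x sum_distrib_left)
    finally show ?thesis .
  qed
  have "expected_cost M P m n (fixed_assignment_policy n pos A)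
      \<le> (\<integral>\<^sup>+\<omega>. ennreal (\<Sum>i<m. max (S i \<omega>) 1) \<partial>M)"
    unfolding expected_cost_def Let_def
  proof (intro nn_integral_mono ennreal_leI sum_mono)
    fix \<omega> i assume \<omega>: "\<omega> \<in> space M"
    let ?p = "\<lambda>j\<in>{..<n}. P j \<omega>"
    have "(\<Sum>j | j < n \<and> A j = i. ?p j) = S i \<omega>"
      unfolding S_def by (intro sum.cong) auto
    then show "max (latest_completion n ?p (fixed_assignment_policy n pos A ?p) i) 1
        \<le> max (S i \<omega>) 1"
      using latest_completion_fixed_assignment_le[of n ?p pos A i] nonneg \<omega> by auto
  qed
  also have "\<dots> = ennreal (expectation (\<lambda>\<omega>. \<Sum>i<m. max (S i \<omega>) 1))"
    using S_int by (intro nn_integral_eq_integral) (auto intro!: sum_nonneg)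
  also have "\<dots> = ennreal (\<Sum>i<m. expectation (\<lambda>\<omega>. max (S i \<omega>) 1))"
    using S_int by (subst Bochner_Integration.integral_sum) auto
  also have "\<dots> \<le> ennreal (\<Sum>i<m. max (x i) 1 + \<rho> * min (x i) 1)"
    by (intro ennreal_leI sum_mono expectation_max_1_le S_int S_nonneg ES dev)
  finally show ?thesis .
qed

lemma lept_load_le_twice:
  assumes lept: "lept_assignment m n \<mu> pos A"
    and nonneg: "\<And>j. j < n \<Longrightarrow> 0 \<le> \<mu> j"
    and jk: "j < n" "k < n" "j \<noteq> k" "A j = i" "A k = i" and i': "i' < m"
  shows "(\<Sum>j | j < n \<and> A j = i. \<mu> j) \<le> 2 * (\<Sum>j | j < n \<and> A j = i'. \<mu> j)"
proof -
  let ?J = "{j. j < n \<and> A j = i}"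
  have inj: "inj_on pos {..<n}" using lept by (simp add: lept_assignment_def)
  have "Max (pos ` ?J) \<in> pos ` ?J" using jk by (intro Max_in) auto
  then obtain h where max: "Max (pos ` ?J) = pos h" and "h \<in> ?J" by (rule imageE)
  moreover have "pos k \<le> pos h" if "k \<in> ?J" for k
    unfolding max[symmetric] using that by (intro Max_ge) auto
  ultimately have h: "h \<in> ?J" "\<And>k. k \<in> ?J \<Longrightarrow> pos k \<le> pos h" by auto
  let ?B = "{k. k < n \<and> pos k < pos h \<and> A k = i}"
  have J: "?J = insert h ?B"
    using h inj by (auto simp: inj_on_def order_less_le)
  then have sum: "(\<Sum>j\<in>?J. \<mu> j) = \<mu> h + (\<Sum>k\<in>?B. \<mu> k)" by simp
  have "j \<in> ?J" "k \<in> ?J" using jk by auto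
  then obtain g where g: "g \<in> ?B" using J jk(3) by (metis insertE)
  have "\<mu> h \<le> \<mu> g" using lept g h by (auto simp: lept_assignment_def)
  also have "\<mu> g \<le> (\<Sum>k\<in>?B. \<mu> k)"
    using g nonneg by (intro member_le_sum) auto
  finally have "\<mu> h \<le> (\<Sum>k\<in>?B. \<mu> k)" .
  moreover have "(\<Sum>k\<in>?B. \<mu> k) \<le> (\<Sum>k | k < n \<and> pos k < pos h \<and> A k = i'. \<mu> k)"
    using lept h i' by (auto simp: lept_assignment_def)
  moreover have "\<dots> \<le> (\<Sum>j | j < n \<and> A j = i'. \<mu> j)"
    using nonneg by (intro sum_mono2) auto
  ultimately show ?thesis using sum by linarith
qed

lemma max_1_le_chord:
  fixes l x :: real
  assumes "1/2 \<le> l" "l \<le> 1" "l \<le> x" "x \<le> 2 * l"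
  shows "max x 1 \<le> (2 - 1/l) * x + (2 - 2 * l)"
proof -
  have "0 \<le> (2 * l - 1) * (x - l)" "0 \<le> (1 - l) * (2 * l - x)"
    using assms by auto
  then show ?thesis using assms by (auto simp: max_def field_simps)
qed

lemma chord_coefficients_sum_le:
  fixes l :: real
  assumes "0 < l"
  shows "(2 - 1/l) + (2 - 2 * l) \<le> 2 * (2 - sqrt 2)"
proof -
  have "0 \<le> (sqrt 2 * l - 1)\<^sup>2" by simp
  also have "\<dots> = 2 * l\<^sup>2 + 1 - 2 * sqrt 2 * l"
    by (simp add: power2_diff power_mult_distrib)
  finally show ?thesis using assms by (simp add: field_simps power2_eq_square)
qed

lemma lept_extended_load_le:
  assumes m: "0 < m" and lept: "lept_assignment m n \<mu> pos A"
    and nonneg: "\<And>j. j < n \<Longrightarrow> 0 \<le> \<mu> j"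
    and x: "\<And>i. x i = (\<Sum>j | j < n \<and> A j = i. \<mu> j)"
  obtains K where "K \<subseteq> {..<n}"
    "\<And>L. (\<Sum>j<n. \<mu> j) \<le> L \<Longrightarrow> (\<Sum>j\<in>K. \<mu> j) + (real m - real (card K)) \<le> L \<Longrightarrow>
         (\<Sum>i<m. max (x i) 1) \<le> 2 * (2 - sqrt 2) * L"
proof -
  define J where "J i = {j. j < n \<and> A j = i}" for i
  define B where "B = {i. i < m \<and> 1 < x i \<and> card (J i) = 1}"
  define K where "K = (\<Union>i\<in>B. J i)"
  define l where "l = Min (x ` {..<m})"
  have A: "A j < m" if "j < n" for j using lept that by (auto simp: lept_assignment_def)
  have finJ: "finite (J i)" for i by (simp add: J_def)
  have finB: "finite B" by (simp add: B_def)
  have T: "(\<Sum>j<n. \<mu> j) = (\<Sum>i<m. x i)"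
    using sum_by_machine[of "{..<n}" A m \<mu>] A by (simp add: x)
  have x_nonneg: "0 \<le> x i" for i unfolding x using nonneg by (intro sum_nonneg) auto
  have disj: "\<forall>i\<in>B. \<forall>i'\<in>B. i \<noteq> i' \<longrightarrow> J i \<inter> J i' = {}" by (auto simp: J_def)
  have "card K = (\<Sum>i\<in>B. card (J i))"
    unfolding K_def using finB finJ disj by (intro card_UN_disjoint) auto
  then have cardK: "card K = card B" by (simp add: B_def)
  have sumK: "(\<Sum>j\<in>K. \<mu> j) = (\<Sum>i\<in>B. x i)"
    unfolding K_def using finB finJ disj
    by (subst sum.UNION_disjoint) (auto simp: x J_def)
  have split: "(\<Sum>i<m. f i) = (\<Sum>i\<in>B. f i) + (\<Sum>i\<in>{..<m} - B. f i)" for f :: "nat \<Rightarrow> real"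
    by (subst add.commute, rule sum.subset_diff) (auto simp: B_def)
  have cardB: "real (card ({..<m} - B)) = real m - real (card B)"
  proof -
    have "B \<subseteq> {..<m}" by (auto simp: B_def)
    then show ?thesis
      using card_mono[of "{..<m}" B] by (simp add: card_Diff_subset finB of_nat_diff)
  qed
  have l_le: "l \<le> x i" if "i < m" for i unfolding l_def using that by auto
  have "l \<in> x ` {..<m}" unfolding l_def using m by (intro Min_in) auto
  then obtain i0 where i0: "i0 < m" "l = x i0" by auto
  have twice: "x i \<le> 2 * l" if i: "i < m" "i \<notin> B" "1 < x i" for i
  proof -
    have "J i \<noteq> {}"
    proof
      assume "J i = {}"
      then have "x i = 0" unfolding x J_def by (simp only: sum.empty)
      then show False using i(3) by simp
    qed
    then obtain j where j: "j \<in> J i" by blast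
    have "card (J i) \<noteq> 1" using i by (auto simp: B_def)
    then have "J i \<noteq> {j}" by auto
    then obtain k where "k \<in> J i" "k \<noteq> j" using j by blast
    then show ?thesis
      using lept_load_le_twice[OF lept nonneg, of j k i i0] j i0 by (auto simp: J_def x)
  qed
  have r: "1 \<le> 2 * (2 - sqrt 2)"
  proof -
    have "sqrt 2 \<le> 3/2" by (rule real_le_lsqrt) (auto simp: power2_eq_square)
    then show ?thesis by simp
  qed
  show ?thesis
  proof (rule that)
    show "K \<subseteq> {..<n}" by (auto simp: K_def J_def)
    fix L assume L1: "(\<Sum>j<n. \<mu> j) \<le> L"
      and "(\<Sum>j\<in>K. \<mu> j) + (real m - real (card K)) \<le> L"
    then have L2: "(\<Sum>i\<in>B. x i) + (real m - real (card B)) \<le> L" by (simp add: sumK cardK)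
    have L0: "0 \<le> L" using L1 T x_nonneg by (metis order_trans sum_nonneg)
    have L_le: "L \<le> 2 * (2 - sqrt 2) * L" using r L0 by (metis mult_le_cancel_right1 not_less)
    consider "1 \<le> l" | "l < 1/2" | "1/2 \<le> l" "l \<le> 1" by linarith
    then show "(\<Sum>i<m. max (x i) 1) \<le> 2 * (2 - sqrt 2) * L"
    proof cases
      case 1
      have "(\<Sum>i<m. max (x i) 1) = (\<Sum>i<m. x i)"
        using l_le 1 by (intro sum.cong) (force simp: max_def)+
      then show ?thesis using T L1 L_le by simp
    next
      case 2
      have "(\<Sum>i\<in>B. max (x i) 1) = (\<Sum>i\<in>B. x i)"
        by (intro sum.cong) (auto simp: B_def)
      moreover have "(\<Sum>i\<in>{..<m} - B. max (x i) 1) = (\<Sum>i\<in>{..<m} - B. 1)"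
        using twice 2 by (intro sum.cong) (force simp: max_def)+
      ultimately have "(\<Sum>i<m. max (x i) 1) = (\<Sum>i\<in>B. x i) + (real m - real (card B))"
        using split[of "\<lambda>i. max (x i) 1"] cardB by simp
      then show ?thesis using L2 L_le by simp
    next
      case 3
      define a b where "a = 2 - 1/l" and "b = 2 - 2 * l"
      have a: "0 \<le> a" using 3 by (simp add: a_def field_simps)
      have b: "0 \<le> b" using 3 by (simp add: b_def)
      have "0 \<le> (2 * l - 1) * (1 - l)" using 3 by simp
      then have ab: "1 \<le> a + b" using 3 by (simp add: a_def b_def field_simps)
      have "(\<Sum>i\<in>B. max (x i) 1) \<le> (\<Sum>i\<in>B. a * x i + b * x i)"
      proof (rule sum_mono)
        fix i assume "i \<in> B"
        then have "max (x i) 1 = 1 * x i" by (simp add: B_def)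
        also have "\<dots> \<le> (a + b) * x i" using ab x_nonneg by (intro mult_right_mono)
        finally show "max (x i) 1 \<le> a * x i + b * x i" by (simp add: distrib_right)
      qed
      moreover have "(\<Sum>i\<in>{..<m} - B. max (x i) 1) \<le> (\<Sum>i\<in>{..<m} - B. a * x i + b)"
      proof (rule sum_mono)
        fix i assume i: "i \<in> {..<m} - B"
        have "x i \<le> 2 * l" using twice[of i] i 3 by fastforce
        then show "max (x i) 1 \<le> a * x i + b"
          unfolding a_def b_def using max_1_le_chord 3 l_le i by auto
      qed
      ultimately have "(\<Sum>i<m. max (x i) 1)
          \<le> a * (\<Sum>i<m. x i) + b * ((\<Sum>i\<in>B. x i) + (real m - real (card B)))"
        using split[of "\<lambda>i. max (x i) 1"] split[of x] cardB
        by (simp add: sum.distrib sum_distrib_left[symmetric] algebra_simps)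
      also have "\<dots> \<le> a * L + b * L"
        using a b L1 L2 T by (intro add_mono mult_left_mono) auto
      also have "\<dots> = (a + b) * L" by (simp add: distrib_right)
      also have "\<dots> \<le> 2 * (2 - sqrt 2) * L"
        using chord_coefficients_sum_le[of l] 3 L0
        by (intro mult_right_mono) (auto simp: a_def b_def)
      finally show ?thesis .
    qed
  qed
qed

theorem theorem6:
  fixes M :: "'a measure" and P :: "nat \<Rightarrow> 'a \<Rightarrow> real" and m n :: nat
    and \<rho> :: real and pos A :: "nat \<Rightarrow> nat"
  assumes "prob_space M"
    and "0 < m" and "m < n"
    and "prob_space.indep_vars M (\<lambda>_. borel) P {..<n}"
    and "\<And>j \<omega>. j < n \<Longrightarrow> \<omega> \<in> space M \<Longrightarrow> 0 \<le> P j \<omega>"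
    and "\<And>j. j < n \<Longrightarrow> integrable M (P j)"
    and "0 \<le> \<rho>" and "\<rho> < 1"
    and "\<And>j. j < n \<Longrightarrow> 0 < (\<integral>\<omega>. P j \<omega> \<partial>M)"
    and "\<And>j. j < n \<Longrightarrow> pietra_index M (P j) \<le> \<rho>"
    and "lept_assignment m n (\<lambda>j. \<integral>\<omega>. P j \<omega> \<partial>M) pos A"
  shows "expected_cost M P m n (fixed_assignment_policy n pos A) / opt_policy_cost M P m n
           \<le> ennreal (2 * (2 - sqrt 2 + \<rho> * (sqrt 2 - 1)))"
proof -
  interpret prob_space M by fact
  note nonneg = assms(5) and int = assms(6)
  define \<mu> where "\<mu> j = expectation (P j)" for j
  define x where "x i = (\<Sum>j | j < n \<and> A j = i. \<mu> j)" for i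
  let ?OPT = "opt_policy_cost M P m n"
  have lept: "lept_assignment m n \<mu> pos A" using assms(11) by (simp add: \<mu>_def[abs_def])
  have \<mu>_nonneg: "0 \<le> \<mu> j" if "j < n" for j using assms(9)[OF that] by (simp add: \<mu>_def)
  have p_nonneg: "0 \<le> p j" if "p \<in> realizations n" "j < n" for p j
    using that by (auto simp: realizations_def PiE_iff)
  have total: "ennreal (\<Sum>j<n. \<mu> j) \<le> ?OPT"
  proof -
    have "ennreal (\<integral>\<omega>. (\<Sum>j<n. (\<lambda>j\<in>{..<n}. P j \<omega>) j) \<partial>M) \<le> ?OPT"
    proof (rule opt_policy_cost_ge[where f = "\<lambda>p. \<Sum>j<n. p j"])
      show "integrable M (\<lambda>\<omega>. \<Sum>j<n. (\<lambda>j\<in>{..<n}. P j \<omega>) j)" using int by auto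
    qed (use nonneg in \<open>auto intro: feasible_cost_ge_total p_nonneg\<close>)
    then show ?thesis using int by (simp add: \<mu>_def)
  qed
  have subset: "ennreal ((\<Sum>j\<in>K. \<mu> j) + (real m - real (card K))) \<le> ?OPT"
    if K: "K \<subseteq> {..<n}" for K
  proof -
    have eq: "(\<Sum>j\<in>K. (\<lambda>j\<in>{..<n}. P j \<omega>) j) = (\<Sum>j\<in>K. P j \<omega>)" for \<omega>
      using K by (intro sum.cong) auto
    have intK: "integrable M (P j)" if "j \<in> K" for j using int K that by auto
    have "ennreal (\<integral>\<omega>. (\<Sum>j\<in>K. (\<lambda>j\<in>{..<n}. P j \<omega>) j) + (real m - real (card K)) \<partial>M) \<le> ?OPT"
    proof (rule opt_policy_cost_ge[where f = "\<lambda>p. (\<Sum>j\<in>K. p j) + (real m - real (card K))"])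
      show "integrable M (\<lambda>\<omega>. (\<Sum>j\<in>K. (\<lambda>j\<in>{..<n}. P j \<omega>) j) + (real m - real (card K)))"
        unfolding eq using intK by auto
    qed (use K nonneg in \<open>auto intro: feasible_cost_ge_subset p_nonneg\<close>)
    then show ?thesis unfolding eq using intK by (simp add: \<mu>_def prob_space)
  qed
  obtain K where K: "K \<subseteq> {..<n}" and
    bound: "\<And>L. (\<Sum>j<n. \<mu> j) \<le> L \<Longrightarrow> (\<Sum>j\<in>K. \<mu> j) + (real m - real (card K)) \<le> L \<Longrightarrow>
         (\<Sum>i<m. max (x i) 1) \<le> 2 * (2 - sqrt 2) * L"
    using lept_extended_load_le[OF assms(2) lept \<mu>_nonneg x_def] by blast
  define L where "L = max (real m) (max (\<Sum>j<n. \<mu> j) ((\<Sum>j\<in>K. \<mu> j) + (real m - real (card K))))"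
  have L_pos: "0 < L" using assms(2) by (simp add: L_def less_max_iff_disj)
  have L_opt: "ennreal L \<le> ?OPT"
    using total subset[OF K] subset[of "{}"] by (simp add: L_def max_def)
  have T: "(\<Sum>i<m. x i) = (\<Sum>j<n. \<mu> j)"
    using sum_by_machine[of "{..<n}" A m \<mu>] lept by (auto simp: x_def lept_assignment_def)
  have "max (x i) 1 + \<rho> * min (x i) 1 = (1 - \<rho>) * max (x i) 1 + \<rho> * (1 + x i)" for i
    by (auto simp: max_def min_def algebra_simps)
  then have "(\<Sum>i<m. max (x i) 1 + \<rho> * min (x i) 1)
      = (1 - \<rho>) * (\<Sum>i<m. max (x i) 1) + \<rho> * (real m + (\<Sum>j<n. \<mu> j))"
    by (simp add: sum.distrib sum_distrib_left[symmetric] T)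
  also have "\<dots> \<le> (1 - \<rho>) * (2 * (2 - sqrt 2) * L) + \<rho> * (L + L)"
    using assms(7,8) by (intro add_mono mult_left_mono bound) (auto simp: L_def)
  also have "\<dots> = 2 * (2 - sqrt 2 + \<rho> * (sqrt 2 - 1)) * L" by (simp add: algebra_simps)
  finally have U: "(\<Sum>i<m. max (x i) 1 + \<rho> * min (x i) 1)
      \<le> 2 * (2 - sqrt 2 + \<rho> * (sqrt 2 - 1)) * L" .
  have "expected_cost M P m n (fixed_assignment_policy n pos A)
      \<le> ennreal (\<Sum>i<m. max (x i) 1 + \<rho> * min (x i) 1)"
    using fixed_assignment_cost_le[OF nonneg int assms(9,10)] by (simp add: x_def \<mu>_def)
  also have "\<dots> \<le> ennreal (2 * (2 - sqrt 2 + \<rho> * (sqrt 2 - 1)) * L)"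
    using U by (rule ennreal_leI)
  also have "\<dots> = ennreal (2 * (2 - sqrt 2 + \<rho> * (sqrt 2 - 1))) * ennreal L"
  proof -
    have "0 \<le> 2 - sqrt 2" using sqrt2_less_2 by simp
    moreover have "0 \<le> \<rho> * (sqrt 2 - 1)" using assms(7) by simp
    ultimately show ?thesis using L_pos by (intro ennreal_mult) auto
  qed
  also have "\<dots> \<le> ennreal (2 * (2 - sqrt 2 + \<rho> * (sqrt 2 - 1))) * ?OPT"
    using L_opt by (rule mult_left_mono) simp
  finally have le: "expected_cost M P m n (fixed_assignment_policy n pos A)
      \<le> ?OPT * ennreal (2 * (2 - sqrt 2 + \<rho> * (sqrt 2 - 1)))" by (simp only: mult.commute)
  have "0 < ennreal L" using L_pos by simp
  also note L_opt
  finally show ?thesis using le by (rule divide_le_posI_ennreal)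
qed

end
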